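(* For any class $\mathbf F\subseteq\mathbf H_{pa}$ of frames, the logic $\mathsf L(\mathbf F)$ has projective approximation.
   Context: A frame is a finite poset with a least element; $\mathsf L(\mathbf F)$ is the set of intuitionistic formulas valid in every Kripke model over every frame of $\mathbf F$. $\mathfrak L_d$ is the $d$-element chain; for $n\ge2$ the $n$-fork $\mathfrak F_n$ is a root with $n$ pairwise incomparable maximal elements; $\mathfrak F_0=\mathfrak L_1$, $\mathfrak F_1=\mathfrak L_2$. For disjoint frames $\mathfrak F=(W,\le_W,w_0)$, $\mathfrak G=(U,\le_U,u_0)$, $\mathfrak F+\mathfrak G$ is $W\cup U$ rooted at $w_0$ with $x\le y$ iff $x\le_W y$ or $x\le_U y$ or ($x\in W$, $y\in U$). $\mathbf H_{pa}$ (also written $\mathbf H_{pr}$) is the class of frames $\mathfrak L_d+\mathfrak F_m$, $d,m\ge0$, with $\mathfrak L_0+\mathfrak F_m=\mathfrak F_m$. For a logic $\mathsf L$: an $\mathsf L$-unifier $\varepsilon$ of $A$ (a substitution with $\varepsilon(A)\in\mathsf L$) is projective if $A\vdash_{\mathsf L}\varepsilon(x)\leftrightarrow x$ for all variables $x$; $A$ is $\mathsf L$-projective if it has a projective unifier; $\mathsf L$ has projective approximation if for every formula $A$ there is a finite set $\Pi(A)$ of $\mathsf L$-projective formulas $B$ with $\mathrm{Var}(B)\subseteq\mathrm{Var}(A)$ and $B\vdash_{\mathsf L}A$, such that every $\mathsf L$-unifier of $A$ is an $\mathsf L$-unifier of some $B\in\Pi(A)$. *)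

theory Defs
  imports Main
begin

section \<open>Formulas, substitutions, derivability\<close>

datatype fm =
    Var nat
  | Bot
  | And fm fm
  | Or fm fm
  | Imp fm fm

definition Iff :: "fm \<Rightarrow> fm \<Rightarrow> fm" where
  "Iff A B = And (Imp A B) (Imp B A)"

primrec vars :: "fm \<Rightarrow> nat set" where
  "vars (Var x) = {x}"
| "vars Bot = {}"
| "vars (And A B) = vars A \<union> vars B"
| "vars (Or A B) = vars A \<union> vars B"
| "vars (Imp A B) = vars A \<union> vars B"

primrec subst :: "(nat \<Rightarrow> fm) \<Rightarrow> fm \<Rightarrow> fm" where
  "subst \<epsilon> (Var x) = \<epsilon> x"
| "subst \<epsilon> Bot = Bot"
| "subst \<epsilon> (And A B) = And (subst \<epsilon> A) (subst \<epsilon> B)"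
| "subst \<epsilon> (Or A B) = Or (subst \<epsilon> A) (subst \<epsilon> B)"
| "subst \<epsilon> (Imp A B) = Imp (subst \<epsilon> A) (subst \<epsilon> B)"

text \<open>A logic is given as its set of theorems.  In derivations from assumptions modus ponens
  is the only rule; in particular, assumptions may not be substituted into.\<close>

inductive derives :: "fm set \<Rightarrow> fm set \<Rightarrow> fm \<Rightarrow> bool" for L \<Gamma> where
  ax: "A \<in> L \<Longrightarrow> derives L \<Gamma> A"
| asm: "A \<in> \<Gamma> \<Longrightarrow> derives L \<Gamma> A"
| mp: "derives L \<Gamma> (Imp A B) \<Longrightarrow> derives L \<Gamma> A \<Longrightarrow> derives L \<Gamma> B"


section \<open>Frames and Kripke semantics\<close>

text \<open>A poset is its reflexive order relation \<open>r\<close>, with \<open>(x, y) \<in> r\<close> for \<open>x \<le> y\<close>; its carrier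
  is \<^term>\<open>Field r\<close>.\<close>

definition frames :: "'w rel set" where
  "frames = {r. Partial_order r \<and> finite (Field r) \<and>
                (\<exists>w\<in>Field r. \<forall>x\<in>Field r. (w, x) \<in> r)}"

definition persistent :: "'w rel \<Rightarrow> ('w \<Rightarrow> nat \<Rightarrow> bool) \<Rightarrow> bool" where
  "persistent r V \<longleftrightarrow> (\<forall>x y p. (x, y) \<in> r \<longrightarrow> V x p \<longrightarrow> V y p)"

primrec forces :: "'w rel \<Rightarrow> ('w \<Rightarrow> nat \<Rightarrow> bool) \<Rightarrow> 'w \<Rightarrow> fm \<Rightarrow> bool" where
  "forces r V w (Var p) \<longleftrightarrow> V w p"
| "forces r V w Bot \<longleftrightarrow> False"
| "forces r V w (And A B) \<longleftrightarrow> forces r V w A \<and> forces r V w B"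
| "forces r V w (Or A B) \<longleftrightarrow> forces r V w A \<or> forces r V w B"
| "forces r V w (Imp A B) \<longleftrightarrow> (\<forall>v. (w, v) \<in> r \<longrightarrow> forces r V v A \<longrightarrow> forces r V v B)"

definition logic_of :: "'w rel set \<Rightarrow> fm set" where
  "logic_of F = {A. \<forall>r\<in>F. \<forall>V. persistent r V \<longrightarrow> (\<forall>w\<in>Field r. forces r V w A)}"


section \<open>The frames \<open>L_d + F_m\<close>\<close>

text \<open>The frames below are described up to isomorphism, as predicates on relations.
  For \<open>d = 0\<close> the chain is the empty relation, so that the sum \<open>L_0 + F_m\<close> is \<open>F_m\<close>.\<close>

definition is_chain :: "nat \<Rightarrow> 'w rel \<Rightarrow> bool" where
  "is_chain d r \<longleftrightarrow> Linear_order r \<and> finite (Field r) \<and> card (Field r) = d"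

text \<open>A root \<open>w\<close> below an antichain \<open>U\<close> of \<open>m\<close> elements.  For \<open>m = 0\<close> and \<open>m = 1\<close> this is the
  chain with one, respectively two, elements.\<close>

definition is_fork :: "nat \<Rightarrow> 'w rel \<Rightarrow> bool" where
  "is_fork m r \<longleftrightarrow> (\<exists>w U. finite U \<and> card U = m \<and> w \<notin> U \<and> r = {w} \<times> insert w U \<union> Id_on U)"

definition frame_sum :: "'w rel \<Rightarrow> 'w rel \<Rightarrow> 'w rel" where
  "frame_sum r s = r \<union> s \<union> Field r \<times> Field s"

definition H_pa :: "'w rel set" where
  "H_pa = {t. \<exists>d m r s. is_chain d r \<and> is_fork m s \<and> Field r \<inter> Field s = {} \<and> t = frame_sum r s}"

lemma is_fork_0: "is_fork 0 r \<longleftrightarrow> is_chain 1 r"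
proof
  assume "is_fork 0 r"
  then obtain w where "r = {(w, w)}" by (auto simp: is_fork_def)
  then show "is_chain 1 r"
    by (auto simp: is_chain_def order_on_defs refl_on_def Field_def trans_def antisym_def total_on_def)
next
  assume c: "is_chain 1 r"
  then obtain w where w: "Field r = {w}" by (auto simp: is_chain_def card_1_singleton_iff)
  have "r \<subseteq> Field r \<times> Field r" by (auto simp: Field_def)
  moreover have "(w, w) \<in> r" using c w by (auto simp: is_chain_def order_on_defs refl_on_def)
  ultimately have "r = {(w, w)}" using w by auto
  then show "is_fork 0 r" by (auto simp: is_fork_def)
qed

lemma is_fork_1: "is_fork 1 r \<longleftrightarrow> is_chain 2 r"
proof
  assume "is_fork 1 r"
  then obtain w u where r: "w \<noteq> u" "r = {(w, w), (w, u), (u, u)}"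
    by (auto simp: is_fork_def card_1_singleton_iff)
  then have "Field r = {w, u}" by (auto simp: Field_def)
  with r show "is_chain 2 r"
    by (auto simp: is_chain_def order_on_defs refl_on_def trans_def antisym_def total_on_def)
next
  assume c: "is_chain 2 r"
  then obtain a b where ab: "a \<noteq> b" "Field r = {a, b}"
    by (auto simp: is_chain_def card_2_iff)
  have sub: "r \<subseteq> Field r \<times> Field r" by (auto simp: Field_def)
  have refl: "(a, a) \<in> r" "(b, b) \<in> r" and tot: "(a, b) \<in> r \<or> (b, a) \<in> r"
    and anti: "\<not> ((a, b) \<in> r \<and> (b, a) \<in> r)"
    using c ab by (auto simp: is_chain_def order_on_defs refl_on_def total_on_def antisym_def)
  obtain w u where wu: "w \<noteq> u" "r = {(w, w), (w, u), (u, u)}"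
  proof (cases "(a, b) \<in> r")
    case True
    then have "r = {(a, a), (a, b), (b, b)}" using sub ab refl anti by auto
    with that ab show thesis by blast
  next
    case False
    then have "r = {(b, b), (b, a), (a, a)}" using sub ab refl tot by auto
    with that[of b a] ab show thesis by blast
  qed
  then have "r = {w} \<times> insert w {u} \<union> Id_on {u}" by auto
  with wu show "is_fork 1 r" unfolding is_fork_def by (intro exI[of _ w] exI[of _ "{u}"]) auto
qed

lemma H_pa_frames: "H_pa \<subseteq> frames"
proof
  fix t :: "'w rel"
  assume "t \<in> H_pa"
  then obtain d m r s where r: "is_chain d r" and s: "is_fork m s"
    and disj: "Field r \<inter> Field s = {}" and t: "t = frame_sum r s"
    by (auto simp: H_pa_def)
  obtain w U where U: "finite U" "w \<notin> U" "s = {w} \<times> insert w U \<union> Id_on U"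
    using s by (auto simp: is_fork_def)
  have Fs: "Field s = insert w U" using U by (auto simp: Field_def)
  have Ft: "Field t = Field r \<union> Field s"
    unfolding t frame_sum_def by (auto simp: Field_def)
  have lin: "Linear_order r" and fin: "finite (Field r)" using r by (auto simp: is_chain_def)
  have rF: "x \<in> Field r" "y \<in> Field r" if "(x, y) \<in> r" for x y using that by (auto simp: Field_def)
  have sF: "x \<in> Field s" "y \<in> Field s" if "(x, y) \<in> s" for x y using that by (auto simp: Field_def)
  have "trans r" "antisym r" and refl_r: "x \<in> Field r \<Longrightarrow> (x, x) \<in> r" for x
    using lin by (auto simp: order_on_defs refl_on_def)
  have "trans s" "antisym s" and refl_s: "x \<in> Field s \<Longrightarrow> (x, x) \<in> s" for x
    using U Fs by (auto simp: trans_def antisym_def)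
  have "trans t"
    unfolding t frame_sum_def using \<open>trans r\<close> \<open>trans s\<close> rF sF disj
    by (intro transI) (blast dest: transD)
  moreover have "antisym t"
    unfolding t frame_sum_def using \<open>antisym r\<close> \<open>antisym s\<close> rF sF disj
    by (intro antisymI) (blast dest: antisymD)
  moreover have "x \<in> Field t \<Longrightarrow> (x, x) \<in> t" for x
    using refl_r refl_s Ft by (auto simp: t frame_sum_def)
  moreover have "t \<subseteq> Field t \<times> Field t" by (auto simp: Field_def)
  ultimately have po: "Partial_order t" by (auto simp: order_on_defs refl_on_def)
  have "\<exists>z\<in>Field t. \<forall>x\<in>Field t. (z, x) \<in> t"
  proof (cases "Field r = {}")
    case True
    then have "w \<in> Field t" "\<forall>x\<in>Field t. (w, x) \<in> t" using Ft Fs U by (auto simp: t frame_sum_def)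
    then show ?thesis by blast
  next
    case False
    have "\<exists>z\<in>A. \<forall>x\<in>A. (z, x) \<in> r" if "finite A" "A \<noteq> {}" "A \<subseteq> Field r" for A
      using that
    proof (induction A rule: finite_ne_induct)
      case (singleton x)
      then show ?case using refl_r by auto
    next
      case (insert a A)
      then obtain z where z: "z \<in> A" "\<forall>x\<in>A. (z, x) \<in> r" by auto
      have "z \<in> Field r" "a \<in> Field r" using insert.prems z by auto
      then have "(a, z) \<in> r \<or> (z, a) \<in> r" "(a, a) \<in> r"
        using lin refl_r by (cases "z = a", auto simp: order_on_defs total_on_def)
      then show ?case using z \<open>trans r\<close> by (metis insert_iff transD)
    qed
    from this[OF fin False] obtain z where "z \<in> Field r" "\<forall>x\<in>Field r. (z, x) \<in> r" by auto
    then have "z \<in> Field t" "\<forall>x\<in>Field t. (z, x) \<in> t" using Ft by (auto simp: t frame_sum_def)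
    then show ?thesis by blast
  qed
  moreover have "finite (Field t)" using fin U(1) unfolding Ft Fs by simp
  ultimately show "t \<in> frames" using po by (simp add: frames_def)
qed


section \<open>Unification\<close>

definition unifier :: "fm set \<Rightarrow> (nat \<Rightarrow> fm) \<Rightarrow> fm \<Rightarrow> bool" where
  "unifier L \<epsilon> A \<longleftrightarrow> subst \<epsilon> A \<in> L"

definition projective_unifier :: "fm set \<Rightarrow> (nat \<Rightarrow> fm) \<Rightarrow> fm \<Rightarrow> bool" where
  "projective_unifier L \<epsilon> A \<longleftrightarrow> unifier L \<epsilon> A \<and> (\<forall>x. derives L {A} (Iff (\<epsilon> x) (Var x)))"

definition projective :: "fm set \<Rightarrow> fm \<Rightarrow> bool" where
  "projective L A \<longleftrightarrow> (\<exists>\<epsilon>. projective_unifier L \<epsilon> A)"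

definition has_projective_approximation :: "fm set \<Rightarrow> bool" where
  "has_projective_approximation L \<longleftrightarrow>
     (\<forall>A. \<exists>P. finite P \<and>
        (\<forall>B\<in>P. projective L B \<and> vars B \<subseteq> vars A \<and> derives L {B} A) \<and>
        (\<forall>\<epsilon>. unifier L \<epsilon> A \<longrightarrow> (\<exists>B\<in>P. unifier L \<epsilon> B)))"

end

theory Submission
  imports Defs
begin

text \<open>Let \<open>\<sigma>\<close> be a unifier of \<open>A\<close>, and let \<open>S\<close> be the set of the classical valuations of
  \<^term>\<open>vars A\<close> that \<open>\<sigma>\<close> induces on one-point models.  The formula \<open>B\<close> saying that \<open>A\<close> holds
  and that all maximal points have their valuation in \<open>S\<close> is unified by \<open>\<sigma>\<close>, and only finitely many
  such \<open>B\<close> arise from a given \<open>A\<close>.  It is projective because a model in which \<open>B\<close> fails at most at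
  the root can be repaired by changing the valuation at the root: if the root has a single immediate
  successor, copy the valuation from there; if it lies below maximal points only, choose
  preimages of these under \<open>\<sigma>\<close>, and take the valuation that \<open>\<sigma>\<close> then induces at the root.
  Ghilardi's substitutions \<open>\<theta>\<^sub>a\<close> carry out these repairs: one pass through all \<open>a \<subseteq> vars A\<close> corrects the
  maximal points, a second one the root of the fork, and \<open>a = UNIV\<close> then corrects the whole chain
  below it at once.\<close>

section \<open>Forcing\<close>

lemma finite_vars: "finite (vars A)"
  by (induction A) auto

lemma forces_subst:
  "forces r V w (subst \<epsilon> C) \<longleftrightarrow> forces r (\<lambda>w x. forces r V w (\<epsilon> x)) w C"
  by (induction C arbitrary: w) auto

text \<open>Each point sees only itself, so forcing is classical truth. Moving to
  \<open>unit\<close> gives one-point models independent of the type of the frame.\<close>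

lemma forces_Id: "forces Id V u C \<longleftrightarrow> forces Id (\<lambda>_ :: unit. V u) () C"
  by (induction C) auto

definition maximal :: "'w rel \<Rightarrow> 'w \<Rightarrow> bool" where
  "maximal r u \<longleftrightarrow> (u, u) \<in> r \<and> (\<forall>v. (u, v) \<in> r \<longrightarrow> v = u)"

lemma forces_maximal:
  assumes "maximal r u"
  shows "forces r V u C \<longleftrightarrow> forces Id (\<lambda>_ :: unit. V u) () C"
proof -
  have "(u, v) \<in> r \<longleftrightarrow> v = u" for v using assms unfolding maximal_def by blast
  then have "forces r V u C \<longleftrightarrow> forces Id V u C" by (induction C) auto
  then show ?thesis using forces_Id[of V u C] by simp
qed

lemma forces_mono:
  assumes "trans r" "persistent r V" "(w, v) \<in> r" "forces r V w C"
  shows "forces r V v C"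
  using assms(3,4) by (induction C) (use assms(1,2) in \<open>auto simp: persistent_def dest: transD\<close>)

lemma forces_cong:
  assumes "trans r"
    and "\<And>u x. u = w \<or> (w, u) \<in> r \<Longrightarrow> x \<in> vars C \<Longrightarrow> V u x \<longleftrightarrow> V' u x"
  shows "forces r V w C \<longleftrightarrow> forces r V' w C"
  using assms(2)
proof (induction C arbitrary: w)
  case (Imp C D)
  have "forces r V v C \<longleftrightarrow> forces r V' v C" "forces r V v D \<longleftrightarrow> forces r V' v D"
    if "(w, v) \<in> r" for v
    using that Imp.prems transD[OF assms(1) that] by (auto intro!: Imp.IH)
  then show ?case by auto
next
  case (And C D)
  have "forces r V w C \<longleftrightarrow> forces r V' w C" "forces r V w D \<longleftrightarrow> forces r V' w D"
    using And.prems by (auto intro!: And.IH)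
  then show ?case by simp
next
  case (Or C D)
  have "forces r V w C \<longleftrightarrow> forces r V' w C" "forces r V w D \<longleftrightarrow> forces r V' w D"
    using Or.prems by (auto intro!: Or.IH)
  then show ?case by simp
qed auto

text \<open>Every strict successor of \<open>w\<close> lies above \<open>v\<close>, so an
  implication at \<open>w\<close> adds to the one at \<open>v\<close> only the instance
  \<open>w\<close> itself, which the induction hypotheses reduce to \<open>v\<close>.\<close>

lemma forces_immediate_successor:
  assumes "trans r" "persistent r V" "(w, w) \<in> r" "(w, v) \<in> r"
    and above: "\<And>u. (w, u) \<in> r \<Longrightarrow> u \<noteq> w \<Longrightarrow> (v, u) \<in> r"
    and eq: "\<And>x. V w x \<longleftrightarrow> V v x"
  shows "forces r V w C \<longleftrightarrow> forces r V v C"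
proof (induction C)
  case (Imp C D)
  then show ?case using assms(1,3,4) above by (auto dest: transD)
qed (use eq in auto)

lemma in_logic_of:
  assumes "A \<in> logic_of F" "r \<in> F" "persistent r V" "w \<in> Field r"
  shows "forces r V w A"
  using assms by (auto simp: logic_of_def)

lemma derives_valid_Imp: "Imp B C \<in> L \<Longrightarrow> derives L {B} C"
  by (auto intro: derives.intros)

section \<open>The repairing substitutions\<close>

text \<open>Both cases reduce to \<open>Var x\<close> where \<open>B\<close> is forced. Where
  \<open>B\<close> fails, a variable in \<open>a\<close> becomes true unless a point above forces
  \<open>B\<close> but not the variable, and all others become false.\<close>

definition ghilardi :: "fm \<Rightarrow> nat set \<Rightarrow> nat \<Rightarrow> fm" where
  "ghilardi B a x = (if x \<in> a then Imp B (Var x) else And B (Var x))"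

text \<open>The order of composition makes the head of the list act first on valuations, as in
  \<open>fold\<close>.\<close>

primrec ghilardis :: "fm \<Rightarrow> nat set list \<Rightarrow> nat \<Rightarrow> fm" where
  "ghilardis B [] = Var"
| "ghilardis B (a # as) = (\<lambda>x. subst (ghilardi B a) (ghilardis B as x))"

definition upd :: "'w rel \<Rightarrow> fm \<Rightarrow> nat set \<Rightarrow> ('w \<Rightarrow> nat \<Rightarrow> bool) \<Rightarrow> 'w \<Rightarrow> nat \<Rightarrow> bool" where
  "upd r B a V = (\<lambda>w x. forces r V w (ghilardi B a x))"

lemma forces_ghilardis: "(\<lambda>w x. forces r V w (ghilardis B as x)) = fold (upd r B) as V"
  by (induction as arbitrary: V) (simp_all add: forces_subst upd_def)

lemma persistent_subst:
  "trans r \<Longrightarrow> persistent r V \<Longrightarrow> persistent r (\<lambda>w x. forces r V w (\<epsilon> x))"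
  using forces_mono[of r V] by (subst persistent_def) blast

lemma persistent_fold_upd:
  "trans r \<Longrightarrow> persistent r V \<Longrightarrow> persistent r (fold (upd r B) as V)"
  by (induction as arbitrary: V) (simp_all add: upd_def persistent_subst)

lemma upd_forced:
  assumes "persistent r V" "(w, w) \<in> r" "forces r V w B"
  shows "upd r B a V w x \<longleftrightarrow> V w x"
  using assms by (auto simp: upd_def ghilardi_def persistent_def)

text \<open>Repairs spoil nothing: \<open>B\<close> is forced on the whole cone above
  \<open>w\<close>, where each update is therefore the identity.\<close>

lemma fold_upd_forced:
  assumes "Partial_order r" "persistent r V" "w \<in> Field r" "forces r V w B"
  shows "forces r (fold (upd r B) as V) w B \<and> fold (upd r B) as V w = V w"
  using assms(2-4)
proof (induction as arbitrary: V)
  case (Cons a as)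
  have tr: "trans r" and refl: "\<And>u. u \<in> Field r \<Longrightarrow> (u, u) \<in> r"
    using assms(1) by (auto simp: order_on_defs refl_on_def)
  have eq: "upd r B a V u x \<longleftrightarrow> V u x" if "u = w \<or> (w, u) \<in> r" for u x
  proof (rule upd_forced)
    show "(u, u) \<in> r" using that refl Cons.prems(2) by (auto simp: Field_def)
    show "forces r V u B" using that forces_mono[OF tr] Cons.prems by blast
  qed fact
  have "forces r (upd r B a V) w B"
    using forces_cong[OF tr, of w B "upd r B a V" V] eq Cons.prems by blast
  moreover have "persistent r (upd r B a V)"
    using tr Cons.prems by (simp add: upd_def persistent_subst)
  moreover have "upd r B a V w = V w" using eq by auto
  ultimately show ?case using Cons.IH Cons.prems by simp
qed simp

section \<open>The approximating formulas\<close>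

text \<open>Negating \<open>char_fm xs s\<close> excludes the valuation \<open>s\<close> of the variables \<open>xs\<close> at maximal points only:
  the formula is forced where every point above has this valuation.\<close>

definition char_fm :: "nat list \<Rightarrow> nat set \<Rightarrow> fm" where
  "char_fm xs s = foldr (\<lambda>x. And (if x \<in> s then Var x else Imp (Var x) Bot)) xs (Imp Bot Bot)"

lemma vars_char_fm: "vars (char_fm xs s) \<subseteq> set xs"
  by (induction xs) (auto simp: char_fm_def)

lemma forces_char_fm:
  "forces r V w (char_fm xs s) \<longleftrightarrow>
     (\<forall>x\<in>set xs. if x \<in> s then V w x else \<forall>v. (w, v) \<in> r \<longrightarrow> \<not> V v x)"
  by (induction xs) (auto simp: char_fm_def)

definition restrict_fm :: "nat list \<Rightarrow> nat set list \<Rightarrow> fm \<Rightarrow> fm" where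
  "restrict_fm xs N A = foldr (\<lambda>s. And (Imp (char_fm xs s) Bot)) N A"

lemma vars_restrict_fm: "vars (restrict_fm xs N A) \<subseteq> set xs \<union> vars A"
  using vars_char_fm by (induction N) (auto simp: restrict_fm_def)

lemma forces_restrict_fm:
  "forces r V w (restrict_fm xs N A) \<longleftrightarrow>
     forces r V w A \<and> (\<forall>s\<in>set N. \<forall>v. (w, v) \<in> r \<longrightarrow> \<not> forces r V v (char_fm xs s))"
  by (induction N) (auto simp: restrict_fm_def)

definition induced_types :: "(nat \<Rightarrow> fm) \<Rightarrow> nat set \<Rightarrow> nat set set" where
  "induced_types \<sigma> X = {{x \<in> X. forces Id (\<lambda>_ :: unit. q) () (\<sigma> x)} | q. True}"

lemma char_fm_maximal:
  assumes "maximal r u" "s \<subseteq> set xs"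
  shows "forces r V u (char_fm xs s) \<longleftrightarrow> s = {x \<in> set xs. V u x}"
proof -
  have "(u, v) \<in> r \<longleftrightarrow> v = u" for v using assms unfolding maximal_def by blast
  then have "forces r V u (char_fm xs s) \<longleftrightarrow> (\<forall>x\<in>set xs. x \<in> s \<longleftrightarrow> V u x)"
    by (auto simp: forces_char_fm)
  then show ?thesis using assms(2) by blast
qed

section \<open>The frames\<close>

text \<open>The two alternatives match the two kinds of repair: only maximal points strictly above,
  or a least strict successor. Well-foundedness of the converse allows induction from the top
  down.\<close>

definition pa_frame :: "'w rel \<Rightarrow> bool" where
  "pa_frame r \<longleftrightarrow> Partial_order r \<and> wf ((r - Id)\<inverse>) \<and>
     (\<forall>w\<in>Field r. (\<forall>u. (w, u) \<in> r \<longrightarrow> u \<noteq> w \<longrightarrow> maximal r u) \<or>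
        (\<exists>v. (w, v) \<in> r \<and> v \<noteq> w \<and> (\<forall>u. (w, u) \<in> r \<longrightarrow> u \<noteq> w \<longrightarrow> (v, u) \<in> r)))"

lemma pa_frame_H_pa:
  assumes "t \<in> H_pa"
  shows "pa_frame t"
proof -
  obtain d m c s where c: "is_chain d c" and s: "is_fork m s"
    and disj: "Field c \<inter> Field s = {}" and t: "t = frame_sum c s"
    using assms by (auto simp: H_pa_def)
  obtain z U where U: "z \<notin> U" "s = {z} \<times> insert z U \<union> Id_on U"
    using s by (auto simp: is_fork_def)
  have Fs: "Field s = insert z U" using U by (auto simp: Field_def)
  have po: "Partial_order t" and fin: "finite (Field t)"
    using assms H_pa_frames by (auto simp: frames_def)
  have "finite t"
    by (rule finite_subset[of _ "Field t \<times> Field t"]) (use fin in \<open>auto simp: Field_def\<close>)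
  moreover have "trans (t - Id)"
    using po by (intro trans_diff_Id) (auto simp: order_on_defs)
  then have "acyclic (t - Id)"
    by (auto simp: acyclic_def)
  ultimately have wf: "wf (t - Id)" "wf ((t - Id)\<inverse>)"
    by (auto intro: finite_acyclic_wf finite_acyclic_wf_converse)
  have cF: "x \<in> Field c" "y \<in> Field c" if "(x, y) \<in> c" for x y using that by (auto simp: Field_def)
  have tot: "(x, y) \<in> c \<or> (y, x) \<in> c" if "x \<in> Field c" "y \<in> Field c" "x \<noteq> y" for x y
    using c that by (auto simp: is_chain_def order_on_defs total_on_def)
  have t_iff: "(x, y) \<in> t \<longleftrightarrow>
      (x, y) \<in> c \<or> x = z \<and> y \<in> insert z U \<or> x = y \<and> x \<in> U \<or> x \<in> Field c \<and> y \<in> insert z U" for x y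
    unfolding t frame_sum_def Fs using U by auto
  have "(\<forall>u. (w, u) \<in> t \<longrightarrow> u \<noteq> w \<longrightarrow> maximal t u) \<or>
        (\<exists>v. (w, v) \<in> t \<and> v \<noteq> w \<and> (\<forall>u. (w, u) \<in> t \<longrightarrow> u \<noteq> w \<longrightarrow> (v, u) \<in> t))"
    if "w \<in> Field t" for w
  proof (cases "w \<in> Field c")
    case True
    \<comment> \<open>The strict successors of \<open>w\<close> include the fork root
      \<open>z\<close>, so they have a minimal element, which turns out to be the least one.\<close>
    have "z \<in> {u. (w, u) \<in> t \<and> u \<noteq> w}" using True disj Fs by (auto simp: t_iff)
    then have "\<exists>v\<in>{u. (w, u) \<in> t \<and> u \<noteq> w}. \<forall>u. (u, v) \<in> t - Id \<longrightarrow> u \<notin> {u. (w, u) \<in> t \<and> u \<noteq> w}"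
      by (rule wf(1)[unfolded wf_eq_minimal, THEN spec, THEN spec, THEN HOL.mp])
    then obtain v where v: "(w, v) \<in> t" "v \<noteq> w"
      and min: "\<And>u. (u, v) \<in> t - Id \<Longrightarrow> \<not> ((w, u) \<in> t \<and> u \<noteq> w)"
      by auto
    have "(v, u) \<in> t" if u: "(w, u) \<in> t" "u \<noteq> w" for u
    proof (cases "v = u")
      case True
      then show ?thesis using po v by (auto simp: order_on_defs refl_on_def Field_def)
    next
      case False
      then have "(u, v) \<notin> t" using min u by blast
      have zw: "(w, z) \<in> t" "z \<noteq> w" using True Fs disj by (auto simp: t_iff)
      have "v \<in> Field c \<or> v \<in> insert z U" "u \<in> Field c \<or> u \<in> insert z U"
        using v u cF by (auto simp: t_iff)
      \<comment> \<open>A leaf of the fork is not minimal, as \<open>z\<close> lies strictly between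
        \<open>w\<close> and it.\<close>
      moreover have "v = z" if "v \<in> insert z U"
      proof (rule ccontr)
        assume "v \<noteq> z"
        with that have "(z, v) \<in> t - Id" by (auto simp: t_iff)
        with min zw show False by blast
      qed
      ultimately show ?thesis using \<open>(u, v) \<notin> t\<close> tot[of u v] False by (auto simp: t_iff)
    qed
    then show ?thesis using v by blast
  next
    case False
    have "maximal t u" if "(w, u) \<in> t" "u \<noteq> w" for u
    proof -
      have "u \<in> U" using that False cF by (auto simp: t_iff)
      then have "u \<noteq> z" "u \<notin> Field c" using U(1) disj Fs by auto
      then have "v = u" if "(u, v) \<in> t" for v using that cF by (auto simp: t_iff)
      then show ?thesis using \<open>u \<in> U\<close> unfolding maximal_def by (auto simp: t_iff)
    qed
    then show ?thesis by blast
  qed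
  then show ?thesis using po wf unfolding pa_frame_def by blast
qed

lemma pa_frame_maximal_above:
  assumes "pa_frame r" "w \<in> Field r"
  obtains u where "(w, u) \<in> r" "maximal r u"
proof -
  have po: "Partial_order r" and wf: "wf ((r - Id)\<inverse>)" using assms by (auto simp: pa_frame_def)
  have refl: "\<And>u. u \<in> Field r \<Longrightarrow> (u, u) \<in> r" and tr: "trans r"
    using po by (auto simp: order_on_defs refl_on_def)
  have "w \<in> {u. (w, u) \<in> r}" using refl[OF assms(2)] by simp
  then have "\<exists>u\<in>{u. (w, u) \<in> r}. \<forall>v. (v, u) \<in> (r - Id)\<inverse> \<longrightarrow> v \<notin> {u. (w, u) \<in> r}"
    by (rule wf[unfolded wf_eq_minimal, THEN spec, THEN spec, THEN HOL.mp])
  then obtain u where u: "(w, u) \<in> r" and max: "\<And>v. (u, v) \<in> r \<Longrightarrow> v \<noteq> u \<Longrightarrow> (w, v) \<notin> r"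
    by auto
  have "maximal r u"
    unfolding maximal_def
  proof (intro conjI allI impI)
    show "(u, u) \<in> r" using u refl by (auto simp: Field_def)
    show "v = u" if "(u, v) \<in> r" for v using max[OF that] transD[OF tr u that] by blast
  qed
  with u that show thesis by blast
qed

section \<open>Projectivity\<close>

text \<open>\<open>N\<close> lists the valuations that \<open>\<sigma>\<close> does not induce;
  beyond \<open>A\<close>, the formula \<open>B\<close> excludes exactly these at maximal
  points.\<close>

locale approximation =
  fixes F :: "'w rel set" and A :: fm and \<sigma> :: "nat \<Rightarrow> fm" and xs :: "nat list"
    and N :: "nat set list" and B :: fm
  assumes pa: "\<And>r. r \<in> F \<Longrightarrow> pa_frame r"
    and unif: "subst \<sigma> A \<in> logic_of F"
    and xs: "set xs = vars A"
    and N: "set N = Pow (vars A) - induced_types \<sigma> (vars A)"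
    and B: "B = restrict_fm xs N A"
begin

lemma vars_B: "vars B \<subseteq> vars A"
  using vars_restrict_fm[of xs N A] by (simp add: B xs)

text \<open>A forbidden \<open>char_fm xs s\<close> forced anywhere would persist to a maximal
  point, but there the valuation produced by \<open>\<sigma>\<close> is an induced one.\<close>

lemma unifier_B: "subst \<sigma> B \<in> logic_of F"
  unfolding logic_of_def
proof (intro CollectI ballI allI impI)
  fix r V w
  assume r: "r \<in> F" and V: "persistent r V" and w: "w \<in> Field r"
  have tr: "trans r" using pa[OF r] by (auto simp: pa_frame_def order_on_defs)
  let ?W = "\<lambda>w x. forces r V w (\<sigma> x)"
  have "False" if s: "s \<in> set N" and v: "(w, v) \<in> r" and f: "forces r ?W v (char_fm xs s)" for s v
  proof -
    obtain u where u: "(v, u) \<in> r" "maximal r u"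
      using pa_frame_maximal_above[OF pa[OF r]] v by (metis FieldI2)
    have "forces r ?W u (char_fm xs s)"
      by (rule forces_mono[OF tr persistent_subst[OF tr V] u(1) f])
    then have "s = {x \<in> vars A. forces Id (\<lambda>_ :: unit. V u) () (\<sigma> x)}"
      using char_fm_maximal[OF u(2), of s xs] s N xs forces_maximal[OF u(2), of V] by auto
    then have "s \<in> induced_types \<sigma> (vars A)" by (auto simp: induced_types_def)
    with s N show False by simp
  qed
  then show "forces r V w (subst \<sigma> B)"
    using in_logic_of[OF unif r V w] by (auto simp: forces_subst B forces_restrict_fm)
qed

lemma valid_Imp_B_A: "Imp B A \<in> logic_of F"
  by (simp add: logic_of_def B forces_restrict_fm)

text \<open>Supplies preimages under \<open>\<sigma>\<close> for maximal points: there
  \<open>B\<close> rules out every valuation that is not induced.\<close>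

lemma type_of_maximal:
  assumes "maximal r u" "forces r V u B"
  obtains q where "\<And>x. x \<in> vars A \<Longrightarrow> forces Id (\<lambda>_ :: unit. q) () (\<sigma> x) \<longleftrightarrow> V u x"
proof -
  let ?s = "{x \<in> vars A. V u x}"
  have "\<not> forces r V u (char_fm xs s)" if "s \<in> set N" for s
    using assms that by (auto simp: B forces_restrict_fm maximal_def)
  then have "?s \<notin> set N" using char_fm_maximal[OF assms(1), of ?s xs V] xs by auto
  then have "?s \<in> induced_types \<sigma> (vars A)" using N by auto
  then obtain q where "?s = {x \<in> vars A. forces Id (\<lambda>_ :: unit. q) () (\<sigma> x)}"
    by (auto simp: induced_types_def)
  then show thesis by (intro that[of q]) blast
qed

text \<open>Evaluating \<open>\<sigma>\<close> over preimages of the maximal points gives a model of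
  \<open>B\<close>, and \<open>a\<close> is its valuation at \<open>w\<close>. The choice depends on
  \<open>V\<close> only strictly above \<open>w\<close>, so \<open>a\<close> still serves after
  other updates have changed the root.\<close>

lemma upd_repairs:
  assumes r: "r \<in> F" and w: "w \<in> Field r"
    and V: "persistent r V"
    and max: "\<And>u. (w, u) \<in> r \<Longrightarrow> u \<noteq> w \<Longrightarrow> maximal r u \<and> forces r V u B"
  obtains a where "a \<subseteq> vars A"
    "\<And>V'. persistent r V' \<Longrightarrow> (\<And>u. (w, u) \<in> r \<Longrightarrow> u \<noteq> w \<Longrightarrow> V' u = V u) \<Longrightarrow>
       \<not> forces r V' w B \<Longrightarrow> forces r (upd r B a V') w B"
proof -
  have po: "Partial_order r" using pa[OF r] by (simp add: pa_frame_def)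
  have tr: "trans r" and ww: "(w, w) \<in> r" using po w by (auto simp: order_on_defs refl_on_def)
  have "\<forall>u. \<exists>q. (w, u) \<in> r \<and> u \<noteq> w \<longrightarrow>
      (\<forall>x\<in>vars A. forces Id (\<lambda>_ :: unit. q) () (\<sigma> x) \<longleftrightarrow> V u x)"
    using max type_of_maximal by metis
  then obtain q where q: "\<And>u x. (w, u) \<in> r \<Longrightarrow> u \<noteq> w \<Longrightarrow> x \<in> vars A \<Longrightarrow>
      forces Id (\<lambda>_ :: unit. q u) () (\<sigma> x) \<longleftrightarrow> V u x"
    by metis
  \<comment> \<open>\<open>Q\<close> is false outside the strict successors of \<open>w\<close>; it
    is persistent because these are maximal.\<close>
  define Q where "Q u x \<longleftrightarrow> (w, u) \<in> r \<and> u \<noteq> w \<and> q u x" for u x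
  have Q: "persistent r Q"
    using max by (fastforce simp: persistent_def Q_def maximal_def)
  let ?W = "\<lambda>u x. forces r Q u (\<sigma> x)"
  have W: "persistent r ?W" by (rule persistent_subst[OF tr Q])
  have W_above: "?W u x \<longleftrightarrow> V u x" if "(w, u) \<in> r" "u \<noteq> w" "x \<in> vars A" for u x
  proof -
    have "Q u = q u" using that by (auto simp: Q_def)
    then show ?thesis using q[OF that] forces_maximal[of r u Q "\<sigma> x"] max that by simp
  qed
  have WB: "forces r ?W w B"
    using in_logic_of[OF unifier_B r Q w] by (simp add: forces_subst)
  define a where "a = {x \<in> vars A. ?W w x}"
  show thesis
  proof (rule that[of a])
    show "a \<subseteq> vars A" by (auto simp: a_def)
    fix V'
    assume V': "persistent r V'" and eq: "\<And>u. (w, u) \<in> r \<Longrightarrow> u \<noteq> w \<Longrightarrow> V' u = V u"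
      and nB: "\<not> forces r V' w B"
    have above: "upd r B a V' u x \<longleftrightarrow> V u x" if u: "(w, u) \<in> r" "u \<noteq> w" for u x
    proof -
      have m: "maximal r u" "forces r V u B" using max u by auto
      then have "forces r V' u B"
        using forces_maximal[OF m(1), of V] forces_maximal[OF m(1), of V'] eq[OF u] by simp
      then show ?thesis using upd_forced[OF V'] m(1) eq[OF u] by (simp add: maximal_def)
    qed
    have root: "upd r B a V' w x \<longleftrightarrow> ?W w x" if x: "x \<in> vars A" for x
    proof (cases "x \<in> a")
      case True
      then have "?W w x" by (simp add: a_def)
      \<comment> \<open>Since \<open>B\<close> fails at \<open>w\<close>, only strict successors
        matter for \<open>Imp B (Var x)\<close>, and there \<open>V'\<close> agrees with
        \<open>?W\<close> on \<open>vars A\<close>.\<close>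
      moreover have "V' u x" if "(w, u) \<in> r" "forces r V' u B" for u
      proof -
        have "u \<noteq> w" using that nB by blast
        moreover have "?W u x" using W \<open>?W w x\<close> that unfolding persistent_def by blast
        ultimately show ?thesis using W_above x that eq by metis
      qed
      ultimately show ?thesis using True by (simp add: upd_def ghilardi_def)
    next
      case False
      then show ?thesis using x nB by (simp add: upd_def ghilardi_def a_def)
    qed
    have "upd r B a V' u x \<longleftrightarrow> ?W u x" if "u = w \<or> (w, u) \<in> r" "x \<in> vars B" for u x
      using that vars_B above W_above root by (metis subsetD)
    then show "forces r (upd r B a V') w B"
      using forces_cong[OF tr, of w B "upd r B a V'" ?W] WB by blast
  qed
qed

text \<open>The right \<open>a\<close> occurs somewhere in \<open>as\<close>. Earlier updates fix
  everything strictly above \<open>w\<close>, so \<open>a\<close> still works when its turn comes;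
  later ones preserve \<open>B\<close>.\<close>

lemma fold_upd_repairs:
  assumes r: "r \<in> F" and w: "w \<in> Field r" and V: "persistent r V"
    and max: "\<And>u. (w, u) \<in> r \<Longrightarrow> u \<noteq> w \<Longrightarrow> maximal r u \<and> forces r V u B"
    and as: "Pow (vars A) \<subseteq> set as"
  shows "forces r (fold (upd r B) as V) w B"
proof -
  have po: "Partial_order r" using pa[OF r] by (simp add: pa_frame_def)
  have tr: "trans r" using po by (simp add: order_on_defs)
  obtain a where a: "a \<subseteq> vars A"
    and repair: "\<And>V'. persistent r V' \<Longrightarrow> (\<And>u. (w, u) \<in> r \<Longrightarrow> u \<noteq> w \<Longrightarrow> V' u = V u) \<Longrightarrow>
       \<not> forces r V' w B \<Longrightarrow> forces r (upd r B a V') w B"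
    using upd_repairs[OF r w V max] by blast
  obtain bs cs where split: "as = bs @ a # cs"
    using a as by (meson PowI split_list subsetD)
  let ?V = "fold (upd r B) bs V"
  have V': "persistent r ?V" by (rule persistent_fold_upd[OF tr V])
  have "?V u = V u" if "(w, u) \<in> r" "u \<noteq> w" for u
    using fold_upd_forced[OF po V] max that by (metis FieldI2)
  then have "forces r (upd r B a ?V) w B"
    using repair[OF V'] fold_upd_forced[OF po V' w, of B "[a]"] by (cases "forces r ?V w B") auto
  moreover have "persistent r (upd r B a ?V)"
    using persistent_fold_upd[OF tr V', of B "[a]"] by simp
  ultimately show ?thesis using fold_upd_forced[OF po _ w] by (simp add: split)
qed

text \<open>Where \<open>B\<close> fails at \<open>w\<close>, the truth of
  \<open>Imp B (Var x)\<close> depends on strict successors only, hence agrees with its truth at the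
  least one. All failing points thus copy their successors simultaneously, and \<open>B\<close>
  descends by induction.\<close>

lemma upd_UNIV_repairs:
  assumes r: "r \<in> F" and V: "persistent r V"
    and fork: "\<And>w. w \<in> Field r \<Longrightarrow> (\<And>u. (w, u) \<in> r \<Longrightarrow> u \<noteq> w \<Longrightarrow> maximal r u) \<Longrightarrow>
      forces r V w B"
    and w: "w \<in> Field r"
  shows "forces r (upd r B UNIV V) w B"
proof -
  have po: "Partial_order r" and wf: "wf ((r - Id)\<inverse>)"
    using pa[OF r] by (auto simp: pa_frame_def)
  have tr: "trans r" and refl: "\<And>u. u \<in> Field r \<Longrightarrow> (u, u) \<in> r"
    using po by (auto simp: order_on_defs refl_on_def)
  let ?V = "upd r B UNIV V"
  have V': "persistent r ?V" using persistent_fold_upd[OF tr V, of B "[UNIV]"] by simp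
  show ?thesis
    using w
  proof (induction w rule: wf_induct_rule[OF wf])
    case (1 w)
    show ?case
    proof (cases "forces r V w B")
      case True
      then show ?thesis using fold_upd_forced[OF po V 1(2), of B "[UNIV]"] by simp
    next
      case False
      then obtain v where v: "(w, v) \<in> r" "v \<noteq> w"
        and above: "\<And>u. (w, u) \<in> r \<Longrightarrow> u \<noteq> w \<Longrightarrow> (v, u) \<in> r"
        using pa[OF r] fork 1(2) unfolding pa_frame_def by metis
      have "?V w x \<longleftrightarrow> ?V v x" for x
        using False above v tr by (auto simp: upd_def ghilardi_def dest: transD)
      then have "forces r ?V w B \<longleftrightarrow> forces r ?V v B"
        by (intro forces_immediate_successor) (use tr V' refl 1(2) v above in auto)
      then show ?thesis using 1 v by (auto simp: Field_def)
    qed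
  qed
qed

lemma projective_B: "projective (logic_of F) B"
proof -
  obtain as where as: "set as = Pow (vars A)"
    using finite_list[of "Pow (vars A)"] finite_vars by auto
  let ?\<epsilon> = "ghilardis B (as @ as @ [UNIV])"
  have "forces r (fold (upd r B) (as @ as @ [UNIV]) V) w B"
    if r: "r \<in> F" and V: "persistent r V" and w: "w \<in> Field r" for r V w
  proof -
    have tr: "trans r" using pa[OF r] by (simp add: pa_frame_def order_on_defs)
    let ?V1 = "fold (upd r B) as V"
    let ?V2 = "fold (upd r B) as ?V1"
    have V1: "persistent r ?V1" by (rule persistent_fold_upd[OF tr V])
    have V2: "persistent r ?V2" by (rule persistent_fold_upd[OF tr V1])
    \<comment> \<open>Nothing lies strictly above a maximal point, so the hypothesis on its
      successors is vacuous.\<close>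
    have max: "forces r ?V1 u B" if "maximal r u" for u
      by (rule fold_upd_repairs[OF r _ V])
        (use that as in \<open>auto simp: maximal_def intro: FieldI1\<close>)
    have "forces r ?V2 u B"
      if "u \<in> Field r" "\<And>v. (u, v) \<in> r \<Longrightarrow> v \<noteq> u \<Longrightarrow> maximal r v" for u
      by (rule fold_upd_repairs[OF r that(1) V1]) (use that(2) max as in auto)
    then show ?thesis using upd_UNIV_repairs[OF r V2 _ w] by simp
  qed
  then have "unifier (logic_of F) ?\<epsilon> B"
    unfolding unifier_def logic_of_def
    by (auto simp: forces_subst forces_ghilardis simp del: fold_append)
  moreover have "derives (logic_of F) {B} (Iff (?\<epsilon> x) (Var x))" for x
  proof (rule derives_valid_Imp)
    \<comment> \<open>No update moves the valuation where \<open>B\<close> is forced.\<close>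
    have "forces r V v (?\<epsilon> x) \<longleftrightarrow> V v x"
      if "r \<in> F" "persistent r V" "v \<in> Field r" "forces r V v B" for r V v
      using fold_upd_forced[of r V v B] pa[OF that(1)] that
      by (simp add: forces_ghilardis[THEN fun_cong, THEN fun_cong] pa_frame_def del: fold_append)
    then have "forces r V u (?\<epsilon> x) \<longleftrightarrow> V u x"
      if "r \<in> F" "persistent r V" "forces r V v B" "(v, u) \<in> r" for r V v u
      using forces_mono[of r V v u B] pa[OF that(1)] that
      by (simp add: pa_frame_def order_on_defs FieldI2)
    then show "Imp B (Iff (?\<epsilon> x) (Var x)) \<in> logic_of F"
      unfolding logic_of_def Iff_def by simp
  qed
  ultimately show ?thesis unfolding projective_def projective_unifier_def by blast
qed

end

theorem theorem4p14:
  fixes F :: "'w rel set"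
  assumes "F \<subseteq> H_pa"
  shows "has_projective_approximation (logic_of F)"
  unfolding has_projective_approximation_def
proof
  fix A
  obtain xs where xs: "set xs = vars A" using finite_list[OF finite_vars] by auto
  obtain ss where ss: "set ss = Pow (vars A)"
    using finite_list[of "Pow (vars A)"] finite_vars by auto
  define b where "b S = restrict_fm xs (filter (\<lambda>s. s \<notin> S) ss) A" for S
  define P where "P = {b (induced_types \<sigma> (vars A)) | \<sigma>. unifier (logic_of F) \<sigma> A}"
  have approx: "approximation F A \<sigma> xs (filter (\<lambda>s. s \<notin> induced_types \<sigma> (vars A)) ss)
      (b (induced_types \<sigma> (vars A)))" if "unifier (logic_of F) \<sigma> A" for \<sigma>
    using assms pa_frame_H_pa that xs ss
    by unfold_locales (auto simp: unifier_def b_def)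
  \<comment> \<open>A unifier enters only through its set of induced types, a subset of the finite
    \<open>Pow (vars A)\<close>.\<close>
  have "P \<subseteq> b ` Pow (Pow (vars A))"
    by (auto simp: P_def induced_types_def)
  then have "finite P" by (rule finite_subset) (simp add: finite_vars)
  moreover have "projective (logic_of F) B \<and> vars B \<subseteq> vars A \<and> derives (logic_of F) {B} A"
    if "B \<in> P" for B
    using that approximation.projective_B[OF approx] approximation.vars_B[OF approx]
      derives_valid_Imp[OF approximation.valid_Imp_B_A[OF approx]]
    by (auto simp: P_def)
  moreover have "\<exists>B\<in>P. unifier (logic_of F) \<epsilon> B" if "unifier (logic_of F) \<epsilon> A" for \<epsilon>
    using that approximation.unifier_B[OF approx[OF that]]
    by (auto simp: P_def unifier_def)
  ultimately show "\<exists>P. finite P \<and>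
      (\<forall>B\<in>P. projective (logic_of F) B \<and> vars B \<subseteq> vars A \<and> derives (logic_of F) {B} A) \<and>
      (\<forall>\<epsilon>. unifier (logic_of F) \<epsilon> A \<longrightarrow> (\<exists>B\<in>P. unifier (logic_of F) \<epsilon> B))"
    by blast
qed

end
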